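(* Let $A=\{a_{ij}\}$, $i=0,1,2,\ldots$, $j=0,1,2,\ldots$, be a double sequence of complex scalars and $g(z)=\sum_{i=0}^{\infty} g_i z^i$, $h(z)=\sum_{j=0}^{\infty} h_j z^j$ complex power series. For $z\in\mathbb{C}$ put $P_{A;g,h}(z)=\{a_{ij}\,g_i\,h_j\,z^{i+j}\}_{i,j=0,1,2,\ldots}$. If $P_{A;g,h}(a)\in B_c$ for some complex number $a\neq 0$, then $P_{A;g,h}(z)\in B_c$ for all complex $z$ satisfying $|z|<|a|$.
   Context: Let $c$ be the space of convergent sequences of complex scalars (with the supremum norm) and $B_c$ the space of bounded linear maps of $c$ into $c$. A double sequence $B=\{b_{ij}\}$, $i=0,1,2,\ldots$, $j=0,1,2,\ldots$, of complex constants acts on $s=[s_1,s_2,\ldots]\in c$ by $B(s)_i=b_{i0}\lim_{k\to\infty}s_k+\sum_{j=1}^{\infty}b_{ij}s_j$ for each row index $i$. One writes $B\in B_c$ if this defines a bounded linear map of $c$ into $c$; equivalently, if (1) $\sup_{i}\sum_{j=0}^{\infty}|b_{ij}|<\infty$; (2) $\lim_{i\to\infty}b_{ij}$ exists for $j=1,2,\ldots$; (3) $\lim_{i\to\infty}\sum_{j=0}^{\infty}b_{ij}$ exists. The convention $z^0=1$ is used for all $z$, including $z=0$. *)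

theory Defs
  imports "HOL-Analysis.Analysis"
begin

typedef cseq = "{s :: nat \<Rightarrow> complex. convergent s}"
  morphisms seq_of Cseq
  by (auto intro: convergent_const)

setup_lifting type_definition_cseq

lemma bdd_above_cseq: "convergent s \<Longrightarrow> bdd_above (range (\<lambda>n. norm (s n :: complex)))"
  by (metis Bseq_eq_bounded convergent_imp_Bseq bounded_imp_bdd_above bounded_norm_comp image_image)

instantiation cseq :: real_normed_vector
begin

lift_definition zero_cseq :: cseq is "\<lambda>_. 0"
  by (rule convergent_const)

lift_definition plus_cseq :: "cseq \<Rightarrow> cseq \<Rightarrow> cseq" is "\<lambda>s t n. s n + t n"
  by (rule convergent_add)

lift_definition minus_cseq :: "cseq \<Rightarrow> cseq \<Rightarrow> cseq" is "\<lambda>s t n. s n - t n"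
  by (rule convergent_diff)

lift_definition uminus_cseq :: "cseq \<Rightarrow> cseq" is "\<lambda>s n. - s n"
  by (simp add: convergent_minus_iff[symmetric])

lift_definition scaleR_cseq :: "real \<Rightarrow> cseq \<Rightarrow> cseq" is "\<lambda>r s n. r *\<^sub>R s n"
  by (rule convergentI, rule tendsto_scaleR[OF tendsto_const convergent_LIMSEQ_iff[THEN iffD1]])

lift_definition norm_cseq :: "cseq \<Rightarrow> real" is "\<lambda>s. SUP n. norm (s n)" .

definition dist_cseq :: "cseq \<Rightarrow> cseq \<Rightarrow> real" where
  "dist_cseq s t = norm (s - t)"

definition sgn_cseq :: "cseq \<Rightarrow> cseq" where
  "sgn_cseq s = scaleR (inverse (norm s)) s"

definition uniformity_cseq :: "(cseq \<times> cseq) filter" where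
  "uniformity_cseq = (INF e\<in>{0<..}. principal {(x, y). dist x y < e})"

definition open_cseq :: "cseq set \<Rightarrow> bool" where
  "open_cseq U \<longleftrightarrow> (\<forall>x\<in>U. \<forall>\<^sub>F (x', y) in uniformity. x' = x \<longrightarrow> y \<in> U)"

instance
proof
  fix x y z :: cseq and a b :: real
  show "x + y + z = x + (y + z)" by transfer (simp add: add.assoc)
  show "x + y = y + x" by transfer (simp add: add.commute)
  show "0 + x = x" by transfer simp
  show "- x + x = 0" by transfer simp
  show "x - y = x + - y" by transfer simp
  show "a *\<^sub>R (x + y) = a *\<^sub>R x + a *\<^sub>R y" by transfer (simp add: scaleR_add_right)
  show "(a + b) *\<^sub>R x = a *\<^sub>R x + b *\<^sub>R x" by transfer (simp add: scaleR_add_left)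
  show "a *\<^sub>R b *\<^sub>R x = (a * b) *\<^sub>R x" by transfer simp
  show "1 *\<^sub>R x = x" by transfer simp
  show "dist x y = norm (x - y)" by (rule dist_cseq_def)
  show "sgn x = scaleR (inverse (norm x)) x" by (rule sgn_cseq_def)
  show "uniformity = (INF e\<in>{0<..}. principal {(x :: cseq, y). dist x y < e})"
    by (rule uniformity_cseq_def)
  show "open U \<longleftrightarrow> (\<forall>x\<in>U. \<forall>\<^sub>F (x', y) in uniformity. x' = x \<longrightarrow> y \<in> U)" for U :: "cseq set"
    by (rule open_cseq_def)
  show "norm x = 0 \<longleftrightarrow> x = 0"
  proof transfer
    fix s :: "nat \<Rightarrow> complex"
    assume s: "convergent s"
    have "norm (s n) \<le> (SUP n. norm (s n))" for n
      by (rule cSUP_upper[OF UNIV_I bdd_above_cseq[OF s]])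
    then show "(SUP n. norm (s n)) = 0 \<longleftrightarrow> s = (\<lambda>_. 0)"
      by (auto intro!: ext)
  qed
  show "norm (x + y) \<le> norm x + norm y"
  proof transfer
    fix s t :: "nat \<Rightarrow> complex"
    assume s: "convergent s" and t: "convergent t"
    show "(SUP n. norm (s n + t n)) \<le> (SUP n. norm (s n)) + (SUP n. norm (t n))"
      by (rule cSUP_least)
        (auto intro!: norm_triangle_le add_mono cSUP_upper bdd_above_cseq s t)
  qed
  show "norm (a *\<^sub>R x) = \<bar>a\<bar> * norm x"
  proof transfer
    fix a :: real and s :: "nat \<Rightarrow> complex"
    assume s: "convergent s"
    have "\<bar>a\<bar> * (SUP n. norm (s n)) = (SUP x\<in>range (\<lambda>n. norm (s n)). \<bar>a\<bar> * x)"
      by (rule continuous_at_Sup_mono)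
        (auto intro!: monoI mult_left_mono continuous_intros bdd_above_cseq s)
    then show "(SUP n. norm (a *\<^sub>R s n)) = \<bar>a\<bar> * (SUP n. norm (s n))"
      by (simp add: image_image)
  qed
qed

end

lift_definition scaleC_cseq :: "complex \<Rightarrow> cseq \<Rightarrow> cseq" is "\<lambda>c s n. c * s n"
  by (rule convergentI, rule tendsto_mult_left[OF convergent_LIMSEQ_iff[THEN iffD1]])

text \<open>
  Elements of \<open>c\<close> are written \<open>[s\<^sub>1, s\<^sub>2, \<dots>]\<close>, so \<open>s\<^sub>j\<close> is \<open>seq_of s (j - 1)\<close>; column \<open>0\<close> of a
  double sequence acts on the limit of \<open>s\<close> and column \<open>Suc j\<close> on \<open>seq_of s j\<close>.  Rows are numbered
  from \<open>0\<close> and need no shift.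
\<close>

definition row_action :: "(nat \<Rightarrow> nat \<Rightarrow> complex) \<Rightarrow> cseq \<Rightarrow> nat \<Rightarrow> complex" where
  "row_action B s i = B i 0 * lim (seq_of s) + (\<Sum>j. B i (Suc j) * seq_of s j)"

text \<open>
  The class \<open>real_normed_vector\<close> only provides real linearity in \<open>bounded_linear\<close>, so complex
  homogeneity is required separately.  Convergence of the row series is also explicit, because
  \<open>suminf\<close> is total.
\<close>

definition Bc :: "(nat \<Rightarrow> nat \<Rightarrow> complex) set" where
  "Bc = {B. (\<forall>s i. summable (\<lambda>j. B i (Suc j) * seq_of s j)) \<and>
            (\<exists>T :: cseq \<Rightarrow> cseq. bounded_linear T \<and>
               (\<forall>\<alpha> s. T (scaleC_cseq \<alpha> s) = scaleC_cseq \<alpha> (T s)) \<and>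
               (\<forall>s. seq_of (T s) = row_action B s))}"

definition P_seq :: "(nat \<Rightarrow> nat \<Rightarrow> complex) \<Rightarrow> complex fps \<Rightarrow> complex fps \<Rightarrow> complex
    \<Rightarrow> nat \<Rightarrow> nat \<Rightarrow> complex" where
  "P_seq A g h z i j = A i j * fps_nth g i * fps_nth h j * z ^ (i + j)"

end

theory Submission
  imports Defs
begin

text \<open>
  Put \<open>B = P_seq A g h a\<close> and \<open>w = z / a\<close>, so that \<open>P_seq A g h z\<close> is the double sequence
  \<open>w\<^sup>i b\<^sub>i\<^sub>j w\<^sup>j\<close> and \<open>norm w < 1\<close>.  All that matters about the two scaling factors is that they tend
  to \<open>0\<close>: the class \<open>Bc\<close> is closed under passing from \<open>b\<^sub>i\<^sub>j\<close> to \<open>u\<^sub>i b\<^sub>i\<^sub>j v\<^sub>j\<close> for any null sequences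
  \<open>u\<close> and \<open>v\<close> (lemma \<open>Bc_null_scaling\<close>).

  If \<open>T\<close> is the operator of \<open>B\<close>, one would like to say that the scaled double sequence acts as
  (multiplication by \<open>u\<close>) \<open>\<circ>\<close> \<open>T\<close> \<open>\<circ>\<close> (multiplication by \<open>v\<close>).  This is right for the columns
  \<open>j \<ge> 1\<close>.  Column \<open>0\<close>, however, acts on the limit of its argument, and the limit is destroyed by
  multiplication with a null sequence.  So that column is restored by the rank-one operator that
  sends \<open>s\<close> to \<open>lim s\<close> times the sequence \<open>u\<^sub>i b\<^sub>i\<^sub>0 v\<^sub>0\<close>.  The latter sequence is convergent because
  \<open>u\<close> is null and column \<open>0\<close> of a member of \<open>Bc\<close> is bounded (lemma \<open>Bc_column_0_bounded\<close>).
\<close>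

lemma convergent_seq_of: "convergent (seq_of s)"
  using seq_of[of s] by simp

lemma norm_seq_of_le: "norm (seq_of s n) \<le> norm s"
  unfolding norm_cseq.rep_eq
  by (rule cSUP_upper[OF UNIV_I bdd_above_cseq[OF convergent_seq_of]])

lemma norm_cseq_leI: "(\<And>n. norm (seq_of s n) \<le> K) \<Longrightarrow> norm s \<le> K"
  unfolding norm_cseq.rep_eq by (rule cSUP_least) auto

lemma cseq_eqI: "(\<And>n. seq_of s n = seq_of t n) \<Longrightarrow> s = t"
  by (simp add: seq_of_inject[symmetric] fun_eq_iff)

lift_definition mult_cseq :: "cseq \<Rightarrow> cseq \<Rightarrow> cseq" is "\<lambda>s t n. s n * t n"
  by (rule convergent_mult)

lemma bounded_linear_mult_cseq: "bounded_linear (mult_cseq u)"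
proof (rule bounded_linear_intro)
  show "mult_cseq u (s + t) = mult_cseq u s + mult_cseq u t" for s t
    by (rule cseq_eqI) (simp add: mult_cseq.rep_eq plus_cseq.rep_eq algebra_simps)
  show "mult_cseq u (r *\<^sub>R s) = r *\<^sub>R mult_cseq u s" for r s
    by (rule cseq_eqI) (simp add: mult_cseq.rep_eq scaleR_cseq.rep_eq)
  show "norm (mult_cseq u s) \<le> norm s * norm u" for s
    by (rule norm_cseq_leI)
      (simp add: mult_cseq.rep_eq norm_mult mult.commute[of "norm s"] mult_mono norm_seq_of_le)
qed

lemma mult_cseq_scaleC: "mult_cseq u (scaleC_cseq \<alpha> s) = scaleC_cseq \<alpha> (mult_cseq u s)"
  by (rule cseq_eqI) (simp add: mult_cseq.rep_eq scaleC_cseq.rep_eq)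

lemma seq_of_LIMSEQ: "seq_of s \<longlonglongrightarrow> lim (seq_of s)"
  using convergent_seq_of convergent_LIMSEQ_iff by blast

lemma lim_add_cseq: "lim (seq_of (s + t)) = lim (seq_of s) + lim (seq_of t)"
  unfolding plus_cseq.rep_eq by (intro limI tendsto_add seq_of_LIMSEQ)

lemma lim_scaleR_cseq: "lim (seq_of (r *\<^sub>R s)) = r *\<^sub>R lim (seq_of s)"
  unfolding scaleR_cseq.rep_eq by (intro limI tendsto_scaleR tendsto_const seq_of_LIMSEQ)

lemma lim_scaleC_cseq: "lim (seq_of (scaleC_cseq \<alpha> s)) = \<alpha> * lim (seq_of s)"
  unfolding scaleC_cseq.rep_eq by (intro limI tendsto_mult tendsto_const seq_of_LIMSEQ)

lemma norm_lim_cseq_le: "norm (lim (seq_of s)) \<le> norm s"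
  by (rule LIMSEQ_le_const2[OF tendsto_norm[OF seq_of_LIMSEQ]]) (auto intro: norm_seq_of_le)

lemma bounded_linear_lim_scaleC: "bounded_linear (\<lambda>s. scaleC_cseq (lim (seq_of s)) r)"
proof (rule bounded_linear_intro)
  show "scaleC_cseq (lim (seq_of (s + t))) r
      = scaleC_cseq (lim (seq_of s)) r + scaleC_cseq (lim (seq_of t)) r" for s t
    unfolding lim_add_cseq
    by (rule cseq_eqI) (simp add: scaleC_cseq.rep_eq plus_cseq.rep_eq algebra_simps)
  show "scaleC_cseq (lim (seq_of (x *\<^sub>R s))) r = x *\<^sub>R scaleC_cseq (lim (seq_of s)) r" for x s
    unfolding lim_scaleR_cseq
    by (rule cseq_eqI) (simp add: scaleC_cseq.rep_eq scaleR_cseq.rep_eq)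
  show "norm (scaleC_cseq (lim (seq_of s)) r) \<le> norm s * norm r" for s
    by (rule norm_cseq_leI)
      (simp add: scaleC_cseq.rep_eq norm_mult mult_mono norm_seq_of_le norm_lim_cseq_le)
qed

text \<open>
  The sequences \<open>[0, \<dots>, 0, 1, 1, \<dots>]\<close> have norm at most \<open>1\<close> and limit \<open>1\<close>.  In each fixed row the action
  on them is \<open>b\<^sub>i\<^sub>0\<close> plus a tail of a convergent series; as the block of zeros grows the tail vanishes,
  so the operator norm bounds \<open>b\<^sub>i\<^sub>0\<close>.
\<close>

lemma Bc_column_0_bounded:
  assumes "B \<in> Bc"
  shows "\<exists>K. \<forall>i. norm (B i 0) \<le> K"
proof -
  from assms obtain T where T: "bounded_linear T" "\<And>s. seq_of (T s) = row_action B s"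
    and summ: "\<And>s i. summable (\<lambda>j. B i (Suc j) * seq_of s j)"
    unfolding Bc_def by blast
  obtain K where K: "\<And>s. norm (T s) \<le> norm s * K" and "K \<ge> 0"
    using bounded_linear.nonneg_bounded[OF T(1)] by blast
  have "norm (B i 0) \<le> K" for i
  proof -
    define e where "e n = Cseq (\<lambda>j. if j < n then 0 else 1)" for n :: nat
    have e_tendsto: "(\<lambda>j. if j < n then 0 else 1 :: complex) \<longlonglongrightarrow> 1" for n :: nat
      by (rule tendsto_eventually) (auto simp: eventually_at_top_linorder intro!: exI[of _ n])
    then have e: "seq_of (e n) = (\<lambda>j. if j < n then 0 else 1)" for n
      unfolding e_def by (subst Cseq_inverse) (auto intro: convergentI)
    have lim_e: "lim (seq_of (e n)) = 1" for n
      unfolding e by (rule limI[OF e_tendsto])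
    have norm_e: "norm (e n) \<le> 1" for n
      by (rule norm_cseq_leI) (simp add: e)
    have b: "summable (\<lambda>j. B i (Suc j))"
      using summ[of i "e 0"] by (simp add: e)
    have row: "row_action B (e n) i = B i 0 + ((\<Sum>j. B i (Suc j)) - (\<Sum>j<n. B i (Suc j)))" for n
    proof -
      have "(\<lambda>j. B i (Suc j) - (if j \<in> {..<n} then B i (Suc j) else 0))
          sums ((\<Sum>j. B i (Suc j)) - (\<Sum>j<n. B i (Suc j)))"
        by (intro sums_diff summable_sums[OF b] sums_If_finite_set) simp
      also have "(\<lambda>j. B i (Suc j) - (if j \<in> {..<n} then B i (Suc j) else 0))
          = (\<lambda>j. B i (Suc j) * seq_of (e n) j)"
        by (auto simp: e)
      finally show ?thesis
        by (simp add: row_action_def lim_e sums_iff)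
    qed
    have "(\<lambda>n. row_action B (e n) i) \<longlonglongrightarrow> B i 0 + ((\<Sum>j. B i (Suc j)) - (\<Sum>j. B i (Suc j)))"
      unfolding row by (intro tendsto_intros summable_LIMSEQ b)
    then have "(\<lambda>n. norm (row_action B (e n) i)) \<longlonglongrightarrow> norm (B i 0)"
      using tendsto_norm by force
    moreover have "norm (row_action B (e n) i) \<le> K" for n
    proof -
      have "norm (row_action B (e n) i) \<le> norm (T (e n))"
        using norm_seq_of_le[of "T (e n)" i] by (simp add: T(2))
      also have "\<dots> \<le> norm (e n) * K"
        by (rule K)
      also have "\<dots> \<le> K"
        using mult_right_mono[OF norm_e \<open>K \<ge> 0\<close>] by simp
      finally show ?thesis .
    qed
    ultimately show ?thesis
      by (intro LIMSEQ_le_const2) auto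
  qed
  then show ?thesis by blast
qed

text \<open>
  Nullity of \<open>v\<close> makes column \<open>0\<close> of \<open>B\<close> invisible to the two-sided multiplication, so that this
  column can be added separately; nullity of \<open>u\<close> makes the added column \<open>u\<^sub>i b\<^sub>i\<^sub>0 v\<^sub>0\<close> convergent,
  although column \<open>0\<close> of \<open>B\<close> need only be bounded.
\<close>

lemma Bc_null_scaling:
  assumes B: "B \<in> Bc" and u: "u \<longlonglongrightarrow> 0" and v: "v \<longlonglongrightarrow> 0"
  shows "(\<lambda>i j. u i * B i j * v j) \<in> Bc"
proof -
  define C where "C = (\<lambda>i j. u i * B i j * v j)"
  from B obtain T where T: "bounded_linear T"
    "\<And>\<alpha> s. T (scaleC_cseq \<alpha> s) = scaleC_cseq \<alpha> (T s)" "\<And>s. seq_of (T s) = row_action B s"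
    and summ: "\<And>s i. summable (\<lambda>j. B i (Suc j) * seq_of s j)"
    unfolding Bc_def by blast
  define U where "U = Cseq u"
  \<comment> \<open>Entry \<open>j\<close> of a sequence is met by column \<open>Suc j\<close>, hence the shift.\<close>
  define V where "V = Cseq (\<lambda>j. v (Suc j))"
  define R where "R = Cseq (\<lambda>i. C i 0)"
  have v': "(\<lambda>j. v (Suc j)) \<longlonglongrightarrow> 0"
    using v by (rule LIMSEQ_Suc)
  have U: "seq_of U = u" and V: "seq_of V = (\<lambda>j. v (Suc j))"
    unfolding U_def V_def using u v' by (auto intro!: Cseq_inverse convergentI)
  have R: "seq_of R = (\<lambda>i. C i 0)"
  proof -
    obtain K where "\<And>i. norm (B i 0) \<le> K"
      using Bc_column_0_bounded[OF B] by blast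
    then have "Bfun (\<lambda>i. B i 0) sequentially"
      by (intro BfunI[of _ K]) simp
    moreover have "Zfun u sequentially"
      using u by (simp add: tendsto_Zfun_iff)
    ultimately have "Zfun (\<lambda>i. u i * B i 0) sequentially"
      by (intro bounded_bilinear.Zfun_prod_Bfun[OF bounded_bilinear_mult])
    then have "(\<lambda>i. u i * B i 0) \<longlonglongrightarrow> 0"
      by (simp add: tendsto_Zfun_iff)
    then have "(\<lambda>i. C i 0) \<longlonglongrightarrow> 0"
      unfolding C_def by (rule tendsto_mult_left_zero)
    then show ?thesis
      unfolding R_def by (auto intro!: Cseq_inverse convergentI)
  qed
  define S where "S s = mult_cseq U (T (mult_cseq V s)) + scaleC_cseq (lim (seq_of s)) R" for s
  have entry: "C i (Suc j) * seq_of s j = u i * (B i (Suc j) * seq_of (mult_cseq V s) j)" for s i j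
    by (simp add: C_def mult_cseq.rep_eq V)
  have "summable (\<lambda>j. C i (Suc j) * seq_of s j)" for s i
    unfolding entry by (intro summable_mult summ)
  moreover have "bounded_linear S"
    unfolding S_def
    by (intro bounded_linear_add bounded_linear_lim_scaleC
        bounded_linear_compose[OF bounded_linear_mult_cseq]
        bounded_linear_compose[OF T(1)] bounded_linear_mult_cseq)
  moreover have "S (scaleC_cseq \<alpha> s) = scaleC_cseq \<alpha> (S s)" for \<alpha> s
    unfolding S_def mult_cseq_scaleC T(2) lim_scaleC_cseq
    by (rule cseq_eqI) (simp add: plus_cseq.rep_eq scaleC_cseq.rep_eq algebra_simps)
  moreover have "seq_of (S s) = row_action C s" for s
  proof
    fix i
    \<comment> \<open>Since \<open>V\<close> is null, column \<open>0\<close> of \<open>B\<close> contributes nothing to the first summand of \<open>S\<close>.\<close>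
    have "seq_of (mult_cseq V s) \<longlonglongrightarrow> 0 * lim (seq_of s)"
      unfolding mult_cseq.rep_eq V by (intro tendsto_mult v' seq_of_LIMSEQ)
    then have "lim (seq_of (mult_cseq V s)) = 0"
      by (simp add: limI)
    then have "row_action B (mult_cseq V s) i = (\<Sum>j. B i (Suc j) * seq_of (mult_cseq V s) j)"
      by (simp add: row_action_def)
    then have "u i * row_action B (mult_cseq V s) i = (\<Sum>j. C i (Suc j) * seq_of s j)"
      unfolding entry by (simp only: suminf_mult[OF summ])
    then show "seq_of (S s) i = row_action C s i"
      by (simp add: S_def plus_cseq.rep_eq scaleC_cseq.rep_eq mult_cseq.rep_eq[of U] U R T(3)
          row_action_def[of C])
  qed
  ultimately show ?thesis
    unfolding Bc_def C_def[symmetric] by blast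
qed

theorem proposition2:
  fixes A :: "nat \<Rightarrow> nat \<Rightarrow> complex" and g h :: "complex fps" and a :: complex
  assumes "a \<noteq> 0" and "P_seq A g h a \<in> Bc"
  shows "\<forall>z :: complex. norm z < norm a \<longrightarrow> P_seq A g h z \<in> Bc"
proof (intro allI impI)
  fix z :: complex
  assume z: "norm z < norm a"
  define w where "w = z / a"
  have "norm w < 1"
    using z assms(1) by (simp add: w_def norm_divide)
  then have "(\<lambda>n. w ^ n) \<longlonglongrightarrow> 0"
    by (rule LIMSEQ_power_zero)
  then have "(\<lambda>i j. w ^ i * P_seq A g h a i j * w ^ j) \<in> Bc"
    by (intro Bc_null_scaling assms(2))
  also have "(\<lambda>i j. w ^ i * P_seq A g h a i j * w ^ j) = P_seq A g h z"
  proof (intro ext)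
    fix i j
    have "z = a * w"
      using assms(1) by (simp add: w_def)
    then show "w ^ i * P_seq A g h a i j * w ^ j = P_seq A g h z i j"
      by (simp add: P_seq_def power_add power_mult_distrib)
  qed
  finally show "P_seq A g h z \<in> Bc" .
qed

end
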